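(* Consider the gradient-descent update of the context. Suppose that at step $k$ the weights with oracle value $0$ are distributed as $D_0[k]=\mathcal N(\mu_0[k],\sigma_0^2[k])$ and the weights with oracle value $1$ as $D_1[k]=\mathcal N(\mu_1[k],\sigma_1^2[k])$, and that these are symmetric to each other with respect to $1/2$, i.e. $\mu_0[k]=1-\mu_1[k]$ and $\sigma_0^2[k]=\sigma_1^2[k]$. Let $\mu_0[k+1],\sigma_0^2[k+1]$ (resp. $\mu_1[k+1],\sigma_1^2[k+1]$) be the mean and variance of the weights with oracle value $0$ (resp. $1$) after one gradient-descent step. Then $$\mu_0[k+1]=1-\mu_1[k+1],\qquad \sigma_0^2[k+1]=\sigma_1^2[k+1].$$
   Context: An XOR node with $N\ge2$ real weights is trained against binary oracle weights $w_i^{\mathrm{true}}\in\{0,1\}$, with i.i.d. Bernoulli$(p_e)$ binary inputs. Let $p_w$ be the proportion of oracle weights equal to $1$ and, for each $i$, let $p_w^{(\setminus i)}$ be the proportion of ones among the oracle weights $w_j^{\mathrm{true}}$, $j\ne i$ (it depends on $i$ only through $w_i^{\mathrm{true}}$). Plain gradient descent with learning rate $\alpha$ means $$w_i[k+1]=w_i[k]-\alpha\,g_i[k],$$ where $g_i[k]$ is the expected gradient (averaged over inputs and over the weights $w_j$, $j\neq i$), given by $$g_i[k]=p_e\Big[(2w_i[k]-1)\big((1-p_w^{(\setminus i)})A_0[k]+p_w^{(\setminus i)}A_1[k]\big)^{N-1}-(2w_i^{\mathrm{true}}-1)\big((1-p_w^{(\setminus i)})B_0[k]+p_w^{(\setminus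 i)}B_1[k]\big)^{N-1}\Big],$$ with $$A_0=4p_e(\mu_0^2+\sigma_0^2)-4p_e\mu_0+1,\quad A_1=4p_e(\mu_1^2+\sigma_1^2)-4p_e\mu_1+1,\quad B_0=1-2p_e\mu_0,\quad B_1=1-2p_e(1-\mu_1)$$ (all evaluated at step $k$). *)

theory Defs
  imports "HOL-Probability.Probability"
begin

text \<open>The normal law with mean \<open>m\<close> and standard deviation \<open>s \<ge> 0\<close>. The case \<open>s = 0\<close> is
  split off because \<open>normal_density m 0\<close> is identically \<open>0\<close>; the law is then the point mass
  at \<open>m\<close>, which a gradient step can produce.\<close>

definition normal_law :: "real \<Rightarrow> real \<Rightarrow> real measure" where
  "normal_law m s =
     (if s = 0 then return borel m else density lborel (\<lambda>x. ennreal (normal_density m s x)))"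

definition frac_ones_except :: "nat \<Rightarrow> (nat \<Rightarrow> real) \<Rightarrow> nat \<Rightarrow> real" where
  "frac_ones_except N wt i = real (card {j. j < N \<and> j \<noteq> i \<and> wt j = 1}) / (real N - 1)"

definition coeff_A :: "real \<Rightarrow> real \<Rightarrow> real \<Rightarrow> real" where
  "coeff_A pe m s = 4 * pe * (m\<^sup>2 + s\<^sup>2) - 4 * pe * m + 1"

definition coeff_B0 :: "real \<Rightarrow> real \<Rightarrow> real" where
  "coeff_B0 pe m0 = 1 - 2 * pe * m0"

definition coeff_B1 :: "real \<Rightarrow> real \<Rightarrow> real" where
  "coeff_B1 pe m1 = 1 - 2 * pe * (1 - m1)"

text \<open>The gradient component \<open>g\<^sub>i\<close> at the value \<open>x\<close> of the \<open>i\<close>-th weight, averaged over the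
  Bernoulli(\<open>pe\<close>) inputs and over the other weights, whose laws have mean and standard deviation
  \<open>m0\<close>, \<open>s0\<close> (oracle value 0) and \<open>m1\<close>, \<open>s1\<close> (oracle value 1).\<close>

definition expected_gradient ::
  "nat \<Rightarrow> (nat \<Rightarrow> real) \<Rightarrow> real \<Rightarrow> real \<Rightarrow> real \<Rightarrow> real \<Rightarrow> real \<Rightarrow> nat \<Rightarrow> real \<Rightarrow> real" where
  "expected_gradient N wt pe m0 s0 m1 s1 i x =
     (let q = frac_ones_except N wt i in
      pe * ((2 * x - 1) * ((1 - q) * coeff_A pe m0 s0 + q * coeff_A pe m1 s1) ^ (N - 1)
            - (2 * wt i - 1) * ((1 - q) * coeff_B0 pe m0 + q * coeff_B1 pe m1) ^ (N - 1)))"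

definition gd_step ::
  "nat \<Rightarrow> (nat \<Rightarrow> real) \<Rightarrow> real \<Rightarrow> real \<Rightarrow> real \<Rightarrow> real \<Rightarrow> real \<Rightarrow> real \<Rightarrow> nat \<Rightarrow> real \<Rightarrow> real" where
  "gd_step N wt pe \<alpha> m0 s0 m1 s1 i x = x - \<alpha> * expected_gradient N wt pe m0 s0 m1 s1 i x"

end

theory Submission
  imports Defs
begin

text \<open>At symmetric laws the gradient step is an affine map of the single weight, f0(x) = (1 -
  2P) x + P - Q for oracle value 0 and f1(x) = (1 - 2P) x + P + Q for oracle value 1, with the same
  P and Q (\<open>gd_step_symmetric\<close>). Hence f0(1 - x) = 1 - f1(x): the step commutes with
  reflection in 1/2. Means follow an affine map, and variances are scaled by the square of its
  slope, here common to both classes (\<open>expectation_affine_normal_law\<close>,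
  \<open>variance_affine_normal_law\<close>), so the symmetry of both moments survives.\<close>

lemma
  assumes "0 \<le> s"
  shows integrable_normal_law: "integrable (normal_law m s) (\<lambda>x. x)"
    and expectation_normal_law: "(LINT x|normal_law m s. x) = m"
    and variance_normal_law: "(LINT x|normal_law m s. (x - m)\<^sup>2) = s\<^sup>2"
proof -
  have "integrable (normal_law m s) (\<lambda>x. x) \<and> (LINT x|normal_law m s. x) = m \<and>
    (LINT x|normal_law m s. (x - m)\<^sup>2) = s\<^sup>2"
  proof (cases "s = 0")
    case True
    then show ?thesis
      by (simp add: normal_law_def integrable_iff_bounded nn_integral_return integral_return)
  next
    case False
    with assms have s: "0 < s" by simp
    have law: "normal_law m s = density lborel (\<lambda>x. ennreal (normal_density m s x))"
      using s by (simp add: normal_law_def)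
    have "integrable (normal_law m s) (\<lambda>x. x)" "(LINT x|normal_law m s. x) = m"
      using integrable_normal_moment_nz_1[OF s, of m] integral_normal_moment_nz_1[OF s, of m]
      unfolding law by (simp_all add: integrable_density integral_density)
    moreover have "(LINT x|normal_law m s. (x - m)\<^sup>2) = s\<^sup>2"
      \<comment> \<open>The even-moment formula (2k)! / ((2 / s^2)^k k!) at k = 1 gives the
        variance.\<close>
      using integral_normal_moment_even[OF s, of m 1] unfolding law
      by (simp add: integral_density fact_2)
    ultimately show ?thesis by blast
  qed
  then show "integrable (normal_law m s) (\<lambda>x. x)" "(LINT x|normal_law m s. x) = m"
    "(LINT x|normal_law m s. (x - m)\<^sup>2) = s\<^sup>2"
    by auto
qed

text \<open>Transfers the two moments of the law of \<open>X\<close> to its affine image; the shift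
  \<open>d\<close> cancels once the mean is subtracted.\<close>

lemma (in prob_space)
  fixes X Y :: "'a \<Rightarrow> real"
  assumes X: "X \<in> borel_measurable M" and law: "distr M borel X = normal_law m s"
    and s: "0 \<le> s" and Y: "\<And>\<omega>. \<omega> \<in> space M \<Longrightarrow> Y \<omega> = c * X \<omega> + d"
  shows expectation_affine_normal_law: "expectation Y = c * m + d"
    and variance_affine_normal_law: "variance Y = c\<^sup>2 * s\<^sup>2"
proof -
  have int: "integrable M X"
    using integrable_normal_law[OF s, of m] X by (simp add: law[symmetric] integrable_distr_eq)
  have EX: "expectation X = m"
    using expectation_normal_law[OF s, of m] X by (simp add: law[symmetric] integral_distr)
  have VX: "expectation (\<lambda>\<omega>. (X \<omega> - m)\<^sup>2) = s\<^sup>2"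
    using variance_normal_law[OF s, of m] X by (simp add: law[symmetric] integral_distr)
  have "expectation Y = expectation (\<lambda>\<omega>. c * X \<omega> + d)"
    by (intro Bochner_Integration.integral_cong) (simp_all add: Y)
  also have "\<dots> = c * m + d"
    using int by (simp add: EX prob_space)
  finally show EY: "expectation Y = c * m + d" .
  have "variance Y = expectation (\<lambda>\<omega>. c\<^sup>2 * (X \<omega> - m)\<^sup>2)"
    unfolding EY
    by (intro Bochner_Integration.integral_cong)
      (simp_all add: Y power_mult_distrib[symmetric] right_diff_distrib)
  then show "variance Y = c\<^sup>2 * s\<^sup>2"
    by (simp add: VX)
qed

text \<open>The mean enters only through m^2 - m = -m (1 - m), which the reflection fixes.\<close>

lemma coeff_A_reflect: "coeff_A pe (1 - m) s = coeff_A pe m s"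
  by (simp add: coeff_A_def power2_eq_square algebra_simps)

lemma coeff_B0_reflect: "coeff_B0 pe (1 - m) = coeff_B1 pe m"
  by (simp add: coeff_B0_def coeff_B1_def)

text \<open>Under the symmetry the two mixtures in the gradient no longer depend on \<open>frac_ones_except\<close>,
  so the slope of the step is the same for both oracle values.\<close>

lemma gd_step_symmetric:
  fixes pe m s \<alpha> :: real and N :: nat
  defines "P \<equiv> \<alpha> * pe * coeff_A pe m s ^ (N - 1)"
    and "Q \<equiv> \<alpha> * pe * coeff_B1 pe m ^ (N - 1)"
  shows "gd_step N wt pe \<alpha> (1 - m) s m s i x = (1 - 2 * P) * x + (P + (2 * wt i - 1) * Q)"
proof -
  have mix: "(1 - q) * a + q * a = a" for q a :: real
    by (simp add: algebra_simps)
  show ?thesis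
    unfolding gd_step_def expected_gradient_def Let_def coeff_A_reflect coeff_B0_reflect mix
      P_def Q_def
    by (simp add: algebra_simps)
qed

theorem propositionF6:
  fixes M :: "'a measure"
    and N :: nat
    and wt :: "nat \<Rightarrow> real"
    and pe \<alpha> :: real
    and W :: "nat \<Rightarrow> nat \<Rightarrow> 'a \<Rightarrow> real"
    and k :: nat
    and \<mu>0 \<sigma>0 \<mu>1 \<sigma>1 :: real
  assumes "prob_space M"
    and "N \<ge> 2"
    and "\<And>i. i < N \<Longrightarrow> wt i \<in> {0, 1}"
    and "0 \<le> pe" and "pe \<le> 1"
    and "\<sigma>0 \<ge> 0" and "\<sigma>1 \<ge> 0"
    and "\<And>i. i < N \<Longrightarrow> W k i \<in> borel_measurable M"
    and "\<And>i. i < N \<Longrightarrow> wt i = 0 \<Longrightarrow> distr M borel (W k i) = normal_law \<mu>0 \<sigma>0"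
    and "\<And>i. i < N \<Longrightarrow> wt i = 1 \<Longrightarrow> distr M borel (W k i) = normal_law \<mu>1 \<sigma>1"
    and "\<And>i \<omega>. i < N \<Longrightarrow> \<omega> \<in> space M \<Longrightarrow>
           W (Suc k) i \<omega> = gd_step N wt pe \<alpha> \<mu>0 \<sigma>0 \<mu>1 \<sigma>1 i (W k i \<omega>)"
    and "\<mu>0 = 1 - \<mu>1" and "\<sigma>0\<^sup>2 = \<sigma>1\<^sup>2"
  shows "\<forall>i<N. \<forall>j<N. wt i = 0 \<longrightarrow> wt j = 1 \<longrightarrow>
           prob_space.expectation M (W (Suc k) i) = 1 - prob_space.expectation M (W (Suc k) j) \<and>
           prob_space.variance M (W (Suc k) i) = prob_space.variance M (W (Suc k) j)"
proof (intro allI impI)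
  fix i j assume ij: "i < N" "j < N" "wt i = 0" "wt j = 1"
  interpret prob_space M by fact
  define P where "P = \<alpha> * pe * coeff_A pe \<mu>1 \<sigma>1 ^ (N - 1)"
  define Q where "Q = \<alpha> * pe * coeff_B1 pe \<mu>1 ^ (N - 1)"
  \<comment> \<open>Equal squares give equal standard deviations because both are
    nonnegative.\<close>
  have \<sigma>: "\<sigma>0 = \<sigma>1"
    using assms by (simp add: power2_eq_iff_nonneg)
  have step: "W (Suc k) l \<omega> = (1 - 2 * P) * W k l \<omega> + (P + (2 * wt l - 1) * Q)"
    if "l < N" "\<omega> \<in> space M" for l \<omega>
    unfolding assms(11)[OF that] \<sigma> \<open>\<mu>0 = 1 - \<mu>1\<close> P_def Q_def by (rule gd_step_symmetric)
  note i = assms(8)[OF ij(1)] assms(9)[OF ij(1,3)] assms(6) step[OF ij(1)]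
  note j = assms(8)[OF ij(2)] assms(10)[OF ij(2,4)] assms(7) step[OF ij(2)]
  \<comment> \<open>The identity behind this is (1 - 2P) (1 - \<mu>1) + P - Q = 1 - ((1 - 2P) \<mu>1
    + P + Q).\<close>
  have "expectation (W (Suc k) i) = 1 - expectation (W (Suc k) j)"
    using expectation_affine_normal_law[OF i] expectation_affine_normal_law[OF j] ij \<open>\<mu>0 = 1 - \<mu>1\<close> by (simp add: algebra_simps)
  \<comment> \<open>The oracle value affects only the offset, so both variances are (1 - 2P)^2
    \<sigma>1^2.\<close>
  moreover have "variance (W (Suc k) i) = variance (W (Suc k) j)"
    using variance_affine_normal_law[OF i] variance_affine_normal_law[OF j] by (simp only: \<sigma>)
  ultimately show "expectation (W (Suc k) i) = 1 - expectation (W (Suc k) j) \<and>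
    variance (W (Suc k) i) = variance (W (Suc k) j)" ..
qed

end
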